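(* Let $m\geq 2$ be an integer, let $(\mathcal H_i)_{0\leq i\leq m}$ be nonzero separable real Hilbert spaces and, for every $i\in\{0,\ldots,m\}$, let $\varnothing\neq\mathbb K_i\subset\mathbb N$ and let $E_i=(e_{i,k})_{k\in\mathbb K_i}$ be an orthonormal basis of $\mathcal H_i$. For every $i\in\{1,\ldots,m\}$, let $W_i\colon\mathcal H_{i-1}\to\mathcal H_i$ be a bounded linear operator, let $b_i\in\mathcal H_i$, let $\alpha_i\in[0,1]$, for every $k\in\mathbb K_i$ let $\varrho_{i,k}\colon\mathbb R\to\mathbb R$ be $\alpha_i$-averaged and such that $\varrho_{i,k}(0)=0$, and let $R_i\colon\mathcal H_i\to\mathcal H_i\colon x\mapsto\sum_{k\in\mathbb K_i}\varrho_{i,k}(\langle x\mid e_{i,k}\rangle)e_{i,k}$. Set $T=T_m\circ\cdots\circ T_1$, where, for every $i\in\{1,\ldots,m\}$, $T_i\colon\mathcal H_{i-1}\to\mathcal H_i\colon x\mapsto R_i(W_ix+b_i)$. Let $\mathcal G_0$ be the normed space obtained by equipping the vector space underlying $\mathcal H_0$ with a norm for which $\mathcal G_0$ is continuously embedded in $\mathcal H_0$, and suppose that $$\big(\forall(\xi_k)_{k\in\mathbb K_0}\in\ell^2(\mathbb K_0)\big)\quad\Bigg\|\sum_{k\in\mathbb K_0}\xi_ke_{0,k}\Bigg\|_{\mathcal G_0}=\Bigg\|\sum_{k\in\mathbb K_0}|\xi_k|e_{0,k}\Bigg\|_{\mathcal G_0}.$$ Let $p\in[1,+\infty]$ and let $\{\omega_k\}_{k\in\mathbb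 K_m}\subset\,]0,+\infty[$ be such that either $p\in[1,2[$ and $\sum_{k\in\mathbb K_m}\omega_k^{2/(2-p)}<+\infty$, or $p\in[2,+\infty]$ and $\sup_{k\in\mathbb K_m}\omega_k<+\infty$. Let $\mathcal G_m$ be the normed space obtained by equipping the vector space underlying $\mathcal H_m$ with the norm $$(\forall x\in\mathcal H_m)\quad\|x\|_{\mathcal G_m}=\begin{cases}\Big(\sum_{k\in\mathbb K_m}\omega_k|\langle x\mid e_{m,k}\rangle|^p\Big)^{1/p},&\text{if }p<+\infty;\\ \sup_{k\in\mathbb K_m}\omega_k|\langle x\mid e_{m,k}\rangle|,&\text{if }p=+\infty.\end{cases}$$ For every $(k_0,\ldots,k_m)\in\mathbb K_0\times\cdots\times\mathbb K_m$, set $$\mu_{k_0,\ldots,k_m}=\langle W_1e_{0,k_0}\mid e_{1,k_1}\rangle\cdots\langle W_me_{m-1,k_{m-1}}\mid e_{m,k_m}\rangle,$$ and suppose that, for every $(k_0,\ldots,k_m)\in\mathbb K_0\times\cdots\times\mathbb K_m$ and every $(l_0,\ldots,l_{m-1})\in\mathbb K_0\times\cdots\times\mathbb K_{m-1}$, $$\mu_{k_0,\ldots,k_{m-1},k_m}\,\mu_{l_0,\ldots,l_{m-1},k_m}\geq 0.$$ Then the Lipschitz constant $$\vartheta_m=\sup\big\{\|W_m\circ\Lambda_{m-1}\circ W_{m-1}\circ\cdots\circ\Lambda_1\circ W_1\|_{\mathcal G_0,\mathcal G_m}\;:\;\Lambda_i\in\mathscr D_{\{1-2\alpha_i,1\}}(E_i)\text{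 for every }i\in\{1,\ldots,m-1\}\big\}$$ of $T\colon\mathcal G_0\to\mathcal G_m$ reduces to $\vartheta_m=\|W_m\circ\cdots\circ W_1\|_{\mathcal G_0,\mathcal G_m}$.
   Context: An operator $R\colon\mathcal H\to\mathcal H$ on a real Hilbert space is nonexpansive if it is $1$-Lipschitzian; for $\alpha\in[0,1]$, it is $\alpha$-averaged if there exists a nonexpansive operator $Q\colon\mathcal H\to\mathcal H$ such that $R=(1-\alpha)\mathrm{Id}+\alpha Q$ (this applies in particular to $\mathcal H=\mathbb R$). A Lipschitz constant of $T\colon\mathcal G_0\to\mathcal G_m$ is any $\theta\geq 0$ such that $\|Tx-Ty\|_{\mathcal G_m}\leq\theta\|x-y\|_{\mathcal G_0}$ for all $x,y$ (not necessarily the smallest one). $\|\cdot\|_{\mathcal G_0,\mathcal G_m}$ denotes the operator norm of linear operators from $\mathcal G_0$ to $\mathcal G_m$. A normed space is continuously embedded in another one with the same underlying vector space if the identity map from the former to the latter is continuous. For an orthonormal basis $E=(e_k)_{k\in\mathbb K}$ of a separable real Hilbert space $\mathcal H$ and a nonempty bounded set $I\subset\mathbb R$, $\mathscr D_I(E)$ is the set of operators $\Lambda\colon\mathcal H\to\mathcal H\colon x\mapsto\sum_{k\in\mathbb K}\lambda_k\langle x\mid e_k\rangle e_k$ with $\{\lambda_k\}_{k\in\mathbb K}\subset I$. *)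

theory Defs
  imports "HOL-Analysis.Analysis"
begin

text \<open>
  A family of Hilbert spaces indexed by a variable range of integers is represented by a family
  of complete subspaces of one ambient real inner product space (which itself need not be
  complete), each with the inherited inner product. Any countable family of separable real
  Hilbert spaces is of this form up to isometric isomorphism: all of them embed in the space of
  square-summable sequences. Accordingly, operators are functions on the ambient
  type of which only the values on the relevant subspace matter.
\<close>

definition hilbert_space_on :: "'a::real_inner set \<Rightarrow> bool" where
  "hilbert_space_on V \<longleftrightarrow> subspace V \<and> complete V"

definition separable_on :: "'a::topological_space set \<Rightarrow> bool" where
  "separable_on V \<longleftrightarrow> separable_space (top_of_set V)"

definition orthonormal_basis_on :: "'a::real_inner set \<Rightarrow> 'k set \<Rightarrow> ('k \<Rightarrow> 'a) \<Rightarrow> bool" where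
  "orthonormal_basis_on V K e \<longleftrightarrow>
     e ` K \<subseteq> V \<and>
     (\<forall>k\<in>K. \<forall>l\<in>K. e k \<bullet> e l = (if k = l then 1 else 0)) \<and>
     closure (span (e ` K)) = V"

definition bounded_linear_between ::
  "'a::real_normed_vector set \<Rightarrow> 'b::real_normed_vector set \<Rightarrow> ('a \<Rightarrow> 'b) \<Rightarrow> bool" where
  "bounded_linear_between V V' A \<longleftrightarrow>
     A ` V \<subseteq> V' \<and>
     (\<forall>x\<in>V. \<forall>y\<in>V. A (x + y) = A x + A y) \<and>
     (\<forall>c. \<forall>x\<in>V. A (c *\<^sub>R x) = c *\<^sub>R A x) \<and>
     (\<exists>B. \<forall>x\<in>V. norm (A x) \<le> B * norm x)"

definition nonexpansive :: "('a::real_inner \<Rightarrow> 'a) \<Rightarrow> bool" where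
  "nonexpansive Q \<longleftrightarrow> lipschitz_on 1 UNIV Q"

definition averaged :: "real \<Rightarrow> ('a::real_inner \<Rightarrow> 'a) \<Rightarrow> bool" where
  "averaged \<alpha> R \<longleftrightarrow>
     (\<exists>Q. nonexpansive Q \<and> (\<forall>x. R x = (1 - \<alpha>) *\<^sub>R x + \<alpha> *\<^sub>R Q x))"

definition diagonal_operators :: "real set \<Rightarrow> 'k set \<Rightarrow> ('k \<Rightarrow> 'a::real_inner) \<Rightarrow> ('a \<Rightarrow> 'a) set" where
  "diagonal_operators I K e =
     {(\<lambda>x. \<Sum>\<^sub>\<infinity>k\<in>K. (l k * (x \<bullet> e k)) *\<^sub>R e k) | l. l ` K \<subseteq> I}"

definition is_norm_on :: "'a::real_vector set \<Rightarrow> ('a \<Rightarrow> real) \<Rightarrow> bool" where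
  "is_norm_on V N \<longleftrightarrow>
     (\<forall>x\<in>V. 0 \<le> N x) \<and>
     (\<forall>x\<in>V. N x = 0 \<longleftrightarrow> x = 0) \<and>
     (\<forall>c. \<forall>x\<in>V. N (c *\<^sub>R x) = \<bar>c\<bar> * N x) \<and>
     (\<forall>x\<in>V. \<forall>y\<in>V. N (x + y) \<le> N x + N y)"

text \<open>
  The distance is set to 0 off the subspace because the locale \<^locale>\<open>Metric_space\<close> requires
  nonnegativity and symmetry on the whole type; the topology does not depend on this.
\<close>

definition norm_topology :: "'a::real_vector set \<Rightarrow> ('a \<Rightarrow> real) \<Rightarrow> 'a topology" where
  "norm_topology V N =
     Metric_space.mtopology V (\<lambda>x y. if x \<in> V \<and> y \<in> V then N (x - y) else 0)"

definition continuously_embedded ::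
  "'a::real_vector set \<Rightarrow> ('a \<Rightarrow> real) \<Rightarrow> ('a \<Rightarrow> real) \<Rightarrow> bool" where
  "continuously_embedded V N N' \<longleftrightarrow>
     continuous_map (norm_topology V N) (norm_topology V N') (\<lambda>x. x)"

text \<open>
  Extended nonnegative values make the supremum meaningful without a boundedness side condition:
  an unbounded operator has operator norm \<open>\<infinity>\<close>.
\<close>

definition operator_norm ::
  "'a set \<Rightarrow> ('a \<Rightarrow> real) \<Rightarrow> ('b \<Rightarrow> real) \<Rightarrow> ('a \<Rightarrow> 'b) \<Rightarrow> ennreal" where
  "operator_norm V N N' A = (SUP x\<in>{x \<in> V. N x \<le> 1}. ennreal (N' (A x)))"

definition is_lipschitz_constant ::
  "'a::minus set \<Rightarrow> ('a \<Rightarrow> real) \<Rightarrow> ('b::minus \<Rightarrow> real) \<Rightarrow> ('a \<Rightarrow> 'b) \<Rightarrow> real \<Rightarrow> bool" where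
  "is_lipschitz_constant V N N' T \<theta> \<longleftrightarrow>
     0 \<le> \<theta> \<and> (\<forall>x\<in>V. \<forall>y\<in>V. N' (T x - T y) \<le> \<theta> * N (x - y))"

definition path_weight ::
  "nat \<Rightarrow> (nat \<Rightarrow> 'a::real_inner \<Rightarrow> 'a) \<Rightarrow> (nat \<Rightarrow> 'k \<Rightarrow> 'a) \<Rightarrow> (nat \<Rightarrow> 'k) \<Rightarrow> real" where
  "path_weight m W e k = (\<Prod>i=1..m. W i (e (i - 1) (k (i - 1))) \<bullet> e i (k i))"

text \<open>
  Below, \<open>fold f [1..<n+1]\<close> is the composition of \<open>f 1\<close>, ..., \<open>f n\<close> in which \<open>f 1\<close> is
  applied first.
\<close>

lemma fold_compose_Suc: "fold f [1..<Suc (Suc n)] = f (Suc n) \<circ> fold f [1..<Suc n]"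
  by simp

end

theory Submission
  imports Defs
begin

text \<open>
  Every difference of outputs can be written as \<open>T x - T y = \<Lambda>\<^sub>m W\<^sub>m \<dots> \<Lambda>\<^sub>1 W\<^sub>1 (x - y)\<close> with diagonal
  operators \<open>\<Lambda>\<^sub>i\<close> whose entries are difference quotients of the activation functions
  (\<open>network_difference\<close>). Averagedness confines these quotients to \<open>[-1, 1]\<close>, which also contains the
  entries \<open>1 - 2\<alpha>\<^sub>i\<close> and \<open>1\<close> of the operators in the supremum that defines \<open>\<theta>\<close>; the products there have
  the same form, with \<open>\<Lambda>\<^sub>m = Id\<close>. So it is enough to compare one
  product with entries in \<open>[-1, 1]\<close> to the product \<open>W = W\<^sub>m \<dots> W\<^sub>1\<close>.

  Expanding along the bases, the coordinate \<open>\<kappa>\<close> of \<open>\<Lambda>\<^sub>m W\<^sub>m \<dots> \<Lambda>\<^sub>1 W\<^sub>1 z\<close> is a sum over the paths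
  \<open>(k\<^sub>0, \<dots>, k\<^sub>m)\<close> with \<open>k\<^sub>m = \<kappa>\<close> of the path weight times entries of the \<open>\<Lambda>\<^sub>i\<close> times the coordinate
  \<open>k\<^sub>0\<close> of \<open>z\<close>. By hypothesis all these weights have the same sign. Replacing the
  entries by \<open>1\<close> and \<open>z\<close> by the vector \<open>\<bar>z\<bar>\<close> whose coordinates are the absolute values removes every
  cancellation, so the coordinate can only grow in absolute value (\<open>domination\<close>). The point is that one
  vector, \<open>\<bar>z\<bar>\<close>, serves all \<open>\<kappa>\<close> simultaneously. A weighted \<open>\<ell>\<^sup>p\<close> norm is monotone in the absolute
  values of the coordinates and the input norm does not distinguish \<open>z\<close> from \<open>\<bar>z\<bar>\<close>, so both
  the Lipschitz bound and \<open>\<theta> \<le> \<parallel>W\<parallel>\<close> follow. The converse inequality is the choice \<open>\<Lambda>\<^sub>i = Id\<close>.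

  The bound \<open>\<parallel>W\<parallel> < \<infinity>\<close> comes from composing \<open>W\<close>, bounded for the Hilbert norms, with the continuous
  embedding of the input space and with the local boundedness of the weighted norm on
  square-summable sequences (\<open>weighted_lp_norm_locally_bounded\<close>).
\<close>

section \<open>Bounded linear operators between subspaces\<close>

lemma bounded_linear_betweenD:
  assumes "bounded_linear_between V V' f"
  shows "x \<in> V \<Longrightarrow> f x \<in> V'"
    and "x \<in> V \<Longrightarrow> y \<in> V \<Longrightarrow> f (x + y) = f x + f y"
    and "x \<in> V \<Longrightarrow> f (c *\<^sub>R x) = c *\<^sub>R f x"
  using assms unfolding bounded_linear_between_def by auto

lemma bounded_linear_between_bound:
  assumes "bounded_linear_between V V' f"
  obtains B where "0 \<le> B" "\<And>x. x \<in> V \<Longrightarrow> norm (f x) \<le> B * norm x"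
proof -
  obtain B where B: "\<And>x. x \<in> V \<Longrightarrow> norm (f x) \<le> B * norm x"
    using assms unfolding bounded_linear_between_def by blast
  have "norm (f x) \<le> max B 0 * norm x" if "x \<in> V" for x
    using B[OF that] mult_right_mono[of B "max B 0" "norm x"] by simp
  then show ?thesis by (intro that[of "max B 0"]) auto
qed

lemma bounded_linear_between_diff:
  assumes "bounded_linear_between V V' f" "subspace V" "x \<in> V" "y \<in> V"
  shows "f (x - y) = f x - f y"
proof -
  have "f (x + (-1) *\<^sub>R y) = f x + (-1) *\<^sub>R f y"
    using assms by (simp only: bounded_linear_betweenD[OF assms(1)] subspace_scale)
  then show ?thesis by simp
qed

lemma bounded_linear_between_compose:
  assumes f: "bounded_linear_between U V f" and g: "bounded_linear_between V V' g"
  shows "bounded_linear_between U V' (g \<circ> f)"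
proof -
  obtain B where B: "0 \<le> B" "\<And>x. x \<in> U \<Longrightarrow> norm (f x) \<le> B * norm x"
    using bounded_linear_between_bound[OF f] by blast
  obtain C where C: "0 \<le> C" "\<And>x. x \<in> V \<Longrightarrow> norm (g x) \<le> C * norm x"
    using bounded_linear_between_bound[OF g] by blast
  have "norm (g (f x)) \<le> (C * B) * norm x" if "x \<in> U" for x
  proof -
    have "norm (g (f x)) \<le> C * norm (f x)"
      using that f by (intro C) (auto dest: bounded_linear_betweenD)
    also have "\<dots> \<le> C * (B * norm x)"
      using B C that by (intro mult_left_mono) auto
    finally show ?thesis by simp
  qed
  then show ?thesis
    using f g unfolding bounded_linear_between_def by (auto simp: image_subset_iff)
qed

text \<open>
  Linearity and the bound are available on \<^term>\<open>V\<close> only, so the limit is taken along partial sums,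
  which remain in \<^term>\<open>V\<close>.
\<close>

lemma bounded_linear_between_has_sum:
  fixes f :: "'a::real_normed_vector \<Rightarrow> 'b::real_normed_vector"
  assumes f: "bounded_linear_between V V' f" and V: "subspace V"
    and g: "(g has_sum s) K" "g ` K \<subseteq> V" and s: "s \<in> V"
  shows "((\<lambda>k. f (g k)) has_sum f s) K"
proof -
  obtain B where B: "0 \<le> B" "\<And>x. x \<in> V \<Longrightarrow> norm (f x) \<le> B * norm x"
    using bounded_linear_between_bound[OF f] by blast
  have zero: "f 0 = 0"
    using bounded_linear_betweenD(3)[OF f, of 0 0] V by (simp add: subspace_0)
  have sums: "sum g F \<in> V \<and> f (sum g F) = (\<Sum>k\<in>F. f (g k))" if "finite F" "F \<subseteq> K" for F
    using that g(2) V f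
    by (induction F) (auto simp: zero subspace_0 subspace_add bounded_linear_betweenD(2)[OF f])
  have lim: "(sum g \<longlongrightarrow> s) (finite_subsets_at_top K)"
    using g(1) by (simp add: has_sum_def)
  have "((\<lambda>F. f (sum g F)) \<longlongrightarrow> f s) (finite_subsets_at_top K)"
  proof (rule Lim_transform_bound[where g = "\<lambda>F. B * norm (sum g F - s)", THEN Lim_null[THEN iffD2]])
    show "\<forall>\<^sub>F F in finite_subsets_at_top K. norm (f (sum g F) - f s) \<le> norm (B * norm (sum g F - s))"
    proof (rule eventually_finite_subsets_at_top_weakI)
      fix F assume F: "finite F" "F \<subseteq> K"
      have "f (sum g F) - f s = f (sum g F - s)"
        using sums[OF F] s by (simp add: bounded_linear_between_diff[OF f V])
      then show "norm (f (sum g F) - f s) \<le> norm (B * norm (sum g F - s))"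
        using B(2)[of "sum g F - s"] B(1) sums[OF F] s V by (simp add: subspace_diff)
    qed
    have "((\<lambda>F. B * norm (sum g F - s)) \<longlongrightarrow> B * 0) (finite_subsets_at_top K)"
      using lim by (intro tendsto_mult_left tendsto_norm_zero LIM_zero)
    then show "((\<lambda>F. B * norm (sum g F - s)) \<longlongrightarrow> 0) (finite_subsets_at_top K)" by simp
  qed
  then have "(sum (\<lambda>k. f (g k)) \<longlongrightarrow> f s) (finite_subsets_at_top K)"
    by (rule Lim_transform_eventually)
       (auto intro!: eventually_finite_subsets_at_top_weakI simp: sums)
  then show ?thesis by (simp add: has_sum_def)
qed

section \<open>Orthonormal bases of complete subspaces\<close>

locale hilbert_basis =
  fixes V :: "'a::real_inner set" and K :: "'k set" and e :: "'k \<Rightarrow> 'a"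
  assumes space: "hilbert_space_on V" and basis: "orthonormal_basis_on V K e"
begin

lemma subspace: "subspace V"
  using space by (simp add: hilbert_space_on_def)

lemma basis_in: "k \<in> K \<Longrightarrow> e k \<in> V"
  using basis by (auto simp: orthonormal_basis_on_def)

lemma orthonormal: "k \<in> K \<Longrightarrow> l \<in> K \<Longrightarrow> e k \<bullet> e l = (if k = l then 1 else 0)"
  using basis by (auto simp: orthonormal_basis_on_def)

lemma norm_finite_combination:
  assumes "finite F" "F \<subseteq> K"
  shows "(norm (\<Sum>k\<in>F. \<xi> k *\<^sub>R e k))\<^sup>2 = (\<Sum>k\<in>F. (\<xi> k)\<^sup>2)"
proof -
  have "(norm (\<Sum>k\<in>F. \<xi> k *\<^sub>R e k))\<^sup>2 = (\<Sum>k\<in>F. (norm (\<xi> k *\<^sub>R e k))\<^sup>2)"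
    using assms orthonormal
    by (intro norm_sum_Pythagorean) (auto simp: pairwise_def orthogonal_def subset_iff)
  also have "\<dots> = (\<Sum>k\<in>F. (\<xi> k)\<^sup>2)"
    using assms orthonormal by (intro sum.cong) (auto simp: norm_eq_sqrt_inner subset_iff)
  finally show ?thesis .
qed

lemma bessel_finite:
  assumes "finite F" "F \<subseteq> K"
  shows "(\<Sum>k\<in>F. (x \<bullet> e k)\<^sup>2) \<le> (norm x)\<^sup>2"
proof -
  let ?s = "\<Sum>k\<in>F. (x \<bullet> e k) *\<^sub>R e k"
  have "x \<bullet> ?s = (\<Sum>k\<in>F. (x \<bullet> e k)\<^sup>2)"
    by (simp add: inner_sum_right power2_eq_square)
  moreover have "?s \<bullet> ?s = (\<Sum>k\<in>F. (x \<bullet> e k)\<^sup>2)"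
    using norm_finite_combination[OF assms, of "\<lambda>k. x \<bullet> e k"] by (simp add: power2_norm_eq_inner)
  moreover have "0 \<le> (x - ?s) \<bullet> (x - ?s)" by (rule inner_ge_zero)
  ultimately show ?thesis
    by (simp add: inner_diff inner_commute[of ?s x] power2_norm_eq_inner)
qed

lemma square_summable_coordinates: "(\<lambda>k. (x \<bullet> e k)\<^sup>2) summable_on K"
  by (rule nonneg_bdd_above_summable_on) (auto intro!: bdd_aboveI bessel_finite)

lemma bessel: "(\<Sum>\<^sub>\<infinity>k\<in>K. (x \<bullet> e k)\<^sup>2) \<le> (norm x)\<^sup>2"
  by (intro infsum_le_finite_sums square_summable_coordinates bessel_finite)

lemma finite_combination_in: "finite F \<Longrightarrow> F \<subseteq> K \<Longrightarrow> (\<Sum>k\<in>F. \<xi> k *\<^sub>R e k) \<in> V"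
  using subspace basis_in by (auto intro!: subspace_sum subspace_scale)

text \<open>
  The ambient space need not be complete, so convergence has to come from completeness of \<^term>\<open>V\<close>:
  orthogonality turns the Cauchy condition for the squared coefficients into the Cauchy condition
  for the partial sums.
\<close>

lemma riesz_fischer:
  assumes "(\<lambda>k. (\<xi> k)\<^sup>2) summable_on K"
  shows "\<exists>x\<in>V. ((\<lambda>k. \<xi> k *\<^sub>R e k) has_sum x) K"
proof -
  let ?s = "\<lambda>F. \<Sum>k\<in>F. \<xi> k *\<^sub>R e k" and ?q = "\<lambda>F. \<Sum>k\<in>F. (\<xi> k)\<^sup>2"
  let ?S = "\<Sum>\<^sub>\<infinity>k\<in>K. (\<xi> k)\<^sup>2"
  let ?F = "filtermap ?s (finite_subsets_at_top K)"
  have "cauchy_filter ?F"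
    unfolding cauchy_filter_metric_filtermap
  proof (intro allI impI)
    fix d :: real assume d: "0 < d"
    have "(?q \<longlongrightarrow> ?S) (finite_subsets_at_top K)"
      using assms by (simp add: infsum_tendsto)
    then have "\<forall>\<^sub>F F in finite_subsets_at_top K. dist (?q F) ?S < (d/2)\<^sup>2"
      using d by (intro tendstoD) auto
    then obtain G where G: "finite G" "G \<subseteq> K"
      "\<forall>F. finite F \<and> G \<subseteq> F \<and> F \<subseteq> K \<longrightarrow> dist (?q F) ?S < (d/2)\<^sup>2"
      unfolding eventually_finite_subsets_at_top by (elim exE conjE)
    have tail: "dist (?s F) (?s G) < d/2" if F: "finite F" "G \<subseteq> F" "F \<subseteq> K" for F
    proof -
      have "?s F - ?s G = ?s (F - G)" and q: "?q F - ?q G = ?q (F - G)"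
        using F by (simp_all only: sum_diff)
      then have "(dist (?s F) (?s G))\<^sup>2 = ?q (F - G)"
        using norm_finite_combination[of "F - G" \<xi>] F by (auto simp: dist_norm)
      also have "\<dots> = ?q F - ?q G" using q by simp
      also have "\<dots> < (d/2)\<^sup>2"
      proof -
        have "?q F \<le> ?S" using F assms by (intro finite_sum_le_infsum) auto
        moreover have "?S - ?q G < (d/2)\<^sup>2" using G(3)[rule_format, of G] G(1,2) by (simp add: dist_real_def)
        ultimately show ?thesis by linarith
      qed
      finally show ?thesis by (rule power_less_imp_less_base) (use d in simp)
    qed
    show "\<exists>P. eventually P (finite_subsets_at_top K) \<and>
              (\<forall>x y. P x \<and> P y \<longrightarrow> dist (?s x) (?s y) < d)"
    proof (intro exI[of _ "\<lambda>F. finite F \<and> G \<subseteq> F \<and> F \<subseteq> K"] conjI allI impI)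
      show "\<forall>\<^sub>F F in finite_subsets_at_top K. finite F \<and> G \<subseteq> F \<and> F \<subseteq> K"
        unfolding eventually_finite_subsets_at_top using G(1,2) by (intro exI[of _ G] conjI) simp_all
      fix F F' assume *: "(finite F \<and> G \<subseteq> F \<and> F \<subseteq> K) \<and> (finite F' \<and> G \<subseteq> F' \<and> F' \<subseteq> K)"
      show "dist (?s F) (?s F') < d"
        using * tail[of F] tail[of F'] by (metis dist_triangle_half_l)
    qed
  qed
  moreover have "?F \<le> principal V"
    unfolding le_principal eventually_filtermap
    by (rule eventually_finite_subsets_at_top_weakI) (rule finite_combination_in)
  moreover have "?F \<noteq> bot" by (simp add: filtermap_bot_iff)
  moreover have "complete V" using space by (simp add: hilbert_space_on_def)
  ultimately obtain x where "x \<in> V" "?F \<le> nhds x"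
    unfolding complete_uniform by meson
  then show ?thesis by (auto simp: has_sum_def filterlim_def)
qed

definition combine :: "('k \<Rightarrow> real) \<Rightarrow> 'a" where
  "combine \<xi> = (\<Sum>\<^sub>\<infinity>k\<in>K. \<xi> k *\<^sub>R e k)"

context
  fixes \<xi> :: "'k \<Rightarrow> real"
  assumes summable: "(\<lambda>k. (\<xi> k)\<^sup>2) summable_on K"
begin

lemma combine_has_sum: "((\<lambda>k. \<xi> k *\<^sub>R e k) has_sum combine \<xi>) K"
  and combine_in: "combine \<xi> \<in> V"
proof -
  obtain x where x: "x \<in> V" "((\<lambda>k. \<xi> k *\<^sub>R e k) has_sum x) K"
    using riesz_fischer[OF summable] by blast
  moreover have "combine \<xi> = x" unfolding combine_def using x(2) by (rule infsumI)
  ultimately show "((\<lambda>k. \<xi> k *\<^sub>R e k) has_sum combine \<xi>) K" "combine \<xi> \<in> V" by simp_all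
qed

lemma inner_combine:
  assumes k: "k \<in> K"
  shows "combine \<xi> \<bullet> e k = \<xi> k"
proof -
  have "((\<lambda>l. (\<xi> l *\<^sub>R e l) \<bullet> e k) has_sum combine \<xi> \<bullet> e k) K"
    using bounded_linear_inner_left combine_has_sum by (rule has_sum_bounded_linear)
  moreover have "((\<lambda>l. (\<xi> l *\<^sub>R e l) \<bullet> e k) has_sum \<xi> k) K"
    using k orthonormal by (intro has_sum_finite_neutralI[of "{k}"]) auto
  ultimately show ?thesis by (rule has_sum_unique)
qed

lemma norm_combine_le:
  assumes "(\<Sum>\<^sub>\<infinity>k\<in>K. (\<xi> k)\<^sup>2) \<le> C\<^sup>2" and "0 \<le> C"
  shows "norm (combine \<xi>) \<le> C"
proof (rule Lim_norm_ubound)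
  show "((\<lambda>F. \<Sum>k\<in>F. \<xi> k *\<^sub>R e k) \<longlongrightarrow> combine \<xi>) (finite_subsets_at_top K)"
    using combine_has_sum by (simp add: has_sum_def)
  show "\<forall>\<^sub>F F in finite_subsets_at_top K. norm (\<Sum>k\<in>F. \<xi> k *\<^sub>R e k) \<le> C"
  proof (rule eventually_finite_subsets_at_top_weakI)
    fix F assume F: "finite F" "F \<subseteq> K"
    have "(norm (\<Sum>k\<in>F. \<xi> k *\<^sub>R e k))\<^sup>2 = (\<Sum>k\<in>F. (\<xi> k)\<^sup>2)"
      using F by (rule norm_finite_combination)
    also have "\<dots> \<le> (\<Sum>\<^sub>\<infinity>k\<in>K. (\<xi> k)\<^sup>2)"
      using F summable by (intro finite_sum_le_infsum) auto
    also note assms(1)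
    finally show "norm (\<Sum>k\<in>F. \<xi> k *\<^sub>R e k) \<le> C" using assms(2) by (rule power2_le_imp_le)
  qed
qed simp

end

text \<open>
  A vector of \<^term>\<open>V\<close> with vanishing coordinates is orthogonal to the closed span of the basis, which
  is \<^term>\<open>V\<close>, hence to itself.
\<close>

lemma eqI_coordinates:
  assumes "x \<in> V" "y \<in> V" and "\<And>k. k \<in> K \<Longrightarrow> x \<bullet> e k = y \<bullet> e k"
  shows "x = y"
proof -
  let ?N = "{z. (x - y) \<bullet> z = 0}"
  have "e ` K \<subseteq> ?N" using assms(3) by (auto simp: inner_diff_left)
  then have "span (e ` K) \<subseteq> ?N" by (intro span_minimal subspace_hyperplane)
  then have "closure (span (e ` K)) \<subseteq> ?N" by (intro closure_minimal closed_hyperplane)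
  moreover have "x - y \<in> closure (span (e ` K))"
    using basis assms(1,2) subspace by (simp add: orthonormal_basis_on_def subspace_diff)
  ultimately have "(x - y) \<bullet> (x - y) = 0" by blast
  then show ?thesis by simp
qed

lemma combine_coordinates:
  assumes "x \<in> V"
  shows "combine (\<lambda>k. x \<bullet> e k) = x"
  using assms square_summable_coordinates
  by (intro eqI_coordinates combine_in inner_combine)

lemma expansion: "x \<in> V \<Longrightarrow> ((\<lambda>k. (x \<bullet> e k) *\<^sub>R e k) has_sum x) K"
  using combine_has_sum[OF square_summable_coordinates, of x] combine_coordinates[of x] by simp

lemma square_summable_comparison:
  fixes \<xi> \<eta> :: "'k \<Rightarrow> real"
  assumes "(\<lambda>k. (\<xi> k)\<^sup>2) summable_on K" and "\<And>k. k \<in> K \<Longrightarrow> \<bar>\<eta> k\<bar> \<le> \<bar>\<xi> k\<bar>"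
  shows "(\<lambda>k. (\<eta> k)\<^sup>2) summable_on K"
  using assms by (intro summable_on_comparison_test[OF assms(1)]) (auto simp: abs_le_square_iff)

definition diag :: "('k \<Rightarrow> real) \<Rightarrow> 'a \<Rightarrow> 'a" where
  "diag l x = (\<Sum>\<^sub>\<infinity>k\<in>K. (l k * (x \<bullet> e k)) *\<^sub>R e k)"

lemma diag_combine: "diag l x = combine (\<lambda>k. l k * (x \<bullet> e k))"
  by (simp add: diag_def combine_def)

context
  fixes l :: "'k \<Rightarrow> real"
  assumes contractive: "\<And>k. k \<in> K \<Longrightarrow> \<bar>l k\<bar> \<le> 1"
begin

lemma square_summable_diag: "(\<lambda>k. (l k * (x \<bullet> e k))\<^sup>2) summable_on K"
  using square_summable_coordinates[of x]
  by (rule square_summable_comparison) (simp add: abs_mult mult_left_le_one_le contractive)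

lemma diag_in: "diag l x \<in> V"
  unfolding diag_combine by (intro combine_in square_summable_diag)

lemma inner_diag: "k \<in> K \<Longrightarrow> diag l x \<bullet> e k = l k * (x \<bullet> e k)"
  unfolding diag_combine using square_summable_diag by (rule inner_combine)

lemma diag_bounded_linear: "bounded_linear_between V V (diag l)"
proof -
  have "norm (diag l x) \<le> 1 * norm x" for x
  proof -
    have "(\<Sum>\<^sub>\<infinity>k\<in>K. (l k * (x \<bullet> e k))\<^sup>2) \<le> (\<Sum>\<^sub>\<infinity>k\<in>K. (x \<bullet> e k)\<^sup>2)"
      using square_summable_diag square_summable_coordinates contractive
      by (intro infsum_mono) (auto simp: abs_le_square_iff[symmetric] abs_mult mult_left_le_one_le)
    also note bessel
    finally show ?thesis unfolding diag_combine mult_1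
      by (intro norm_combine_le square_summable_diag) auto
  qed
  moreover have "diag l (x + y) = diag l x + diag l y" for x y
    using subspace
    by (intro eqI_coordinates) (auto intro!: diag_in subspace_add simp: inner_add_left inner_diag algebra_simps)
  moreover have "diag l (c *\<^sub>R x) = c *\<^sub>R diag l x" for c x
    using subspace
    by (intro eqI_coordinates) (auto intro!: diag_in subspace_scale simp: inner_diag algebra_simps)
  ultimately show ?thesis
    unfolding bounded_linear_between_def using diag_in by blast
qed

end

lemma diag_one: "x \<in> V \<Longrightarrow> (\<And>k. k \<in> K \<Longrightarrow> l k = 1) \<Longrightarrow> diag l x = x"
  by (intro eqI_coordinates) (auto intro!: diag_in simp: inner_diag)

lemma diagonal_operators_eq: "diagonal_operators I K e = {diag l |l. l ` K \<subseteq> I}"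
  by (simp add: diagonal_operators_def diag_def[abs_def])

text \<open>
  This is how paths arise: it splits a functional of the output of one layer into contributions of
  the basis vectors that the signal may pass through.
\<close>

lemma functional_expansion:
  fixes f :: "'a \<Rightarrow> real"
  assumes f: "bounded_linear_between V UNIV f" and x: "x \<in> V"
  shows "((\<lambda>k. (x \<bullet> e k) * f (e k)) has_sum f x) K"
proof -
  have "((\<lambda>k. f ((x \<bullet> e k) *\<^sub>R e k)) has_sum f x) K"
    using subspace basis_in
    by (intro bounded_linear_between_has_sum[OF f] expansion x) (auto intro: subspace_scale)
  then show ?thesis
    by (rule has_sum_cong[THEN iffD1, rotated])
       (simp add: bounded_linear_betweenD(3)[OF f] basis_in)
qed

definition modulus :: "'a \<Rightarrow> 'a" where
  "modulus x = combine (\<lambda>k. \<bar>x \<bullet> e k\<bar>)"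

lemma square_summable_modulus: "(\<lambda>k. \<bar>x \<bullet> e k\<bar>\<^sup>2) summable_on K"
  using square_summable_coordinates by simp

lemma modulus_in: "modulus x \<in> V"
  unfolding modulus_def by (intro combine_in square_summable_modulus)

lemma inner_modulus: "k \<in> K \<Longrightarrow> modulus x \<bullet> e k = \<bar>x \<bullet> e k\<bar>"
  unfolding modulus_def by (intro inner_combine square_summable_modulus)

lemma activation_in:
  assumes "\<And>k. k \<in> K \<Longrightarrow> \<bar>\<rho> k (u \<bullet> e k)\<bar> \<le> \<bar>u \<bullet> e k\<bar>"
  shows "combine (\<lambda>k. \<rho> k (u \<bullet> e k)) \<in> V"
    and "k \<in> K \<Longrightarrow> combine (\<lambda>k. \<rho> k (u \<bullet> e k)) \<bullet> e k = \<rho> k (u \<bullet> e k)"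
  using square_summable_comparison[OF square_summable_coordinates assms]
  by (auto intro: combine_in inner_combine)

text \<open>
  A contraction of the line acts on a pair of points as multiplication of their difference by a number
  in \<open>[-1, 1]\<close>; applied in each coordinate, this linearizes a layer at the pair \<open>u\<close>, \<open>v\<close>. Where the
  coordinates agree, the quotient is \<open>0 / 0 = 0\<close>, which is harmless because it multiplies \<open>0\<close>.
\<close>

lemma activation_difference:
  assumes "\<And>k s t. k \<in> K \<Longrightarrow> \<bar>\<rho> k s - \<rho> k t\<bar> \<le> \<bar>s - t\<bar>" "\<And>k. k \<in> K \<Longrightarrow> \<rho> k 0 = 0"
  shows "combine (\<lambda>k. \<rho> k (u \<bullet> e k)) - combine (\<lambda>k. \<rho> k (v \<bullet> e k)) =
    diag (\<lambda>k. (\<rho> k (u \<bullet> e k) - \<rho> k (v \<bullet> e k)) / (u \<bullet> e k - v \<bullet> e k)) (u - v)"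
    (is "?a u - ?a v = diag ?l (u - v)")
proof -
  have le: "\<bar>\<rho> k t\<bar> \<le> \<bar>t\<bar>" if "k \<in> K" for k t
    using assms(1)[OF that, of t 0] assms(2)[OF that] by simp
  have l: "\<bar>?l k\<bar> \<le> 1" if "k \<in> K" for k
    using assms(1)[OF that, of "u \<bullet> e k" "v \<bullet> e k"] by (auto simp: abs_divide divide_le_eq_1)
  show ?thesis
  proof (rule eqI_coordinates)
    show "?a u - ?a v \<in> V" using subspace le by (intro subspace_diff activation_in(1))
    show "diag ?l (u - v) \<in> V" using l by (rule diag_in)
    fix k assume k: "k \<in> K"
    have "(?a u - ?a v) \<bullet> e k = \<rho> k (u \<bullet> e k) - \<rho> k (v \<bullet> e k)"
      using k le by (simp add: inner_diff_left activation_in(2))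
    also have "\<dots> = ?l k * (u \<bullet> e k - v \<bullet> e k)"
      by simp
    also have "\<dots> = diag ?l (u - v) \<bullet> e k"
      using inner_diag[where l = ?l, OF l k] by (simp add: inner_diff_left)
    finally show "(?a u - ?a v) \<bullet> e k = diag ?l (u - v) \<bullet> e k" .
  qed
qed

end

section \<open>Weighted lp norms\<close>

definition weighted_lp_norm :: "'k set \<Rightarrow> ('k \<Rightarrow> real) \<Rightarrow> ereal \<Rightarrow> ('k \<Rightarrow> real) \<Rightarrow> real" where
  "weighted_lp_norm K \<omega> p \<xi> =
     (if p < \<infinity> then (\<Sum>\<^sub>\<infinity>k\<in>K. \<omega> k * \<bar>\<xi> k\<bar> powr real_of_ereal p) powr (1 / real_of_ereal p)
      else (SUP k\<in>K. \<omega> k * \<bar>\<xi> k\<bar>))"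

locale lp_weights =
  fixes K :: "'k set" and \<omega> :: "'k \<Rightarrow> real" and p :: ereal
  assumes nonempty: "K \<noteq> {}" and p: "1 \<le> p" and pos: "\<And>k. k \<in> K \<Longrightarrow> 0 < \<omega> k"
    and weights: "(p < 2 \<and> (\<lambda>k. \<omega> k powr (2 / (2 - real_of_ereal p))) summable_on K) \<or>
                  (2 \<le> p \<and> bdd_above (\<omega> ` K))"
begin

text \<open>
  Each term of the norm is dominated by a summable sequence plus a multiple of the square of the
  coordinate. For \<open>p < 2\<close> this is Young's inequality with exponents \<open>2 / (2 - p)\<close> and \<open>2 / p\<close>; for
  \<open>p \<ge> 2\<close> it uses \<open>\<bar>t\<bar> powr p \<le> M powr (p - 2) * t\<^sup>2\<close>, whence the restriction to bounded \<open>t\<close>.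
\<close>

lemma term_bound:
  assumes fin: "p < \<infinity>" and M: "0 \<le> M"
  obtains c C where "c summable_on K" "0 \<le> C"
    "\<And>k t. k \<in> K \<Longrightarrow> \<bar>t\<bar> \<le> M \<Longrightarrow> \<omega> k * \<bar>t\<bar> powr real_of_ereal p \<le> c k + C * t\<^sup>2"
proof -
  obtain q where q: "p = ereal q" "1 \<le> q"
    using p fin by (cases p) auto
  from weights show thesis
  proof (elim disjE conjE)
    assume lt: "p < 2" and sm: "(\<lambda>k. \<omega> k powr (2 / (2 - real_of_ereal p))) summable_on K"
    have q2: "q < 2" using lt q by simp
    have bound: "\<omega> k * \<bar>t\<bar> powr q \<le> \<omega> k powr (2 / (2 - q)) + 1 * t\<^sup>2" if k: "k \<in> K" for k t
    proof (cases "t = 0")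
      case False
      have "(\<omega> k powr (2 / (2 - q))) powr ((2 - q) / 2) * (t\<^sup>2) powr (q / 2)
            \<le> (2 - q) / 2 * \<omega> k powr (2 / (2 - q)) + q / 2 * t\<^sup>2"
        using False q q2 pos[OF k] by (intro Youngs_inequality_0) (auto simp: field_simps)
      also have "\<dots> \<le> 1 * \<omega> k powr (2 / (2 - q)) + 1 * t\<^sup>2"
        using q q2 by (intro add_mono mult_right_mono) auto
      also have "(\<omega> k powr (2 / (2 - q))) powr ((2 - q) / 2) = \<omega> k"
      proof -
        have "2 / (2 - q) * ((2 - q) / 2) = 1" using q2 by simp
        then show ?thesis using pos[OF k] by (simp only: powr_powr powr_one less_imp_le)
      qed
      also have "(t\<^sup>2) powr (q / 2) = \<bar>t\<bar> powr q"
      proof -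
        have "t\<^sup>2 = \<bar>t\<bar> powr 2" using False by (simp add: powr_numeral)
        then show ?thesis by (simp only: powr_powr) simp
      qed
      finally show ?thesis by simp
    qed auto
    show thesis by (rule that[OF sm, of 1]) (use bound q in auto)
  next
    assume ge: "2 \<le> p" and bdd: "bdd_above (\<omega> ` K)"
    have q2: "2 \<le> q" using ge q by simp
    obtain B where B: "\<And>k. k \<in> K \<Longrightarrow> \<omega> k \<le> B"
      using bdd by (auto simp: bdd_above_def)
    have B0: "0 \<le> B" using nonempty B pos by (metis all_not_in_conv less_le_trans less_imp_le)
    have bound: "\<omega> k * \<bar>t\<bar> powr q \<le> 0 + (B * M powr (q - 2)) * t\<^sup>2" if k: "k \<in> K" and t: "\<bar>t\<bar> \<le> M" for k t
    proof (cases "t = 0")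
      case False
      have "\<bar>t\<bar> powr q = \<bar>t\<bar> powr (q - 2) * t\<^sup>2"
      proof -
        have "t\<^sup>2 = \<bar>t\<bar> powr 2" using False by (simp add: powr_numeral)
        then show ?thesis by (simp only: powr_add[symmetric]) simp
      qed
      also have "\<dots> \<le> M powr (q - 2) * t\<^sup>2"
        using t q2 by (intro mult_right_mono powr_mono2) auto
      finally show ?thesis
        using B[OF k] B0 pos[OF k] mult_mono[of "\<omega> k" B "\<bar>t\<bar> powr q" "M powr (q - 2) * t\<^sup>2"] by simp
    qed auto
    show thesis
      by (rule that[of "\<lambda>_. 0" "B * M powr (q - 2)"]) (use bound q B0 in auto)
  qed
qed

lemma coordinate_bound:
  assumes "(\<lambda>k. (\<xi> k)\<^sup>2) summable_on K" "k \<in> K"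
  shows "\<bar>\<xi> k\<bar> \<le> sqrt (\<Sum>\<^sub>\<infinity>k\<in>K. (\<xi> k)\<^sup>2)"
  using finite_sum_le_infsum[OF assms(1), of "{k}"] assms(2)
  by (intro real_le_rsqrt) simp

lemma summable_terms:
  assumes "(\<lambda>k. (\<xi> k)\<^sup>2) summable_on K" "p < \<infinity>"
  shows "(\<lambda>k. \<omega> k * \<bar>\<xi> k\<bar> powr real_of_ereal p) summable_on K"
proof -
  obtain c C where c: "c summable_on K" "0 \<le> C"
    "\<And>k t. k \<in> K \<Longrightarrow> \<bar>t\<bar> \<le> sqrt (\<Sum>\<^sub>\<infinity>k\<in>K. (\<xi> k)\<^sup>2) \<Longrightarrow>
       \<omega> k * \<bar>t\<bar> powr real_of_ereal p \<le> c k + C * t\<^sup>2"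
    using term_bound[OF assms(2), of "sqrt (\<Sum>\<^sub>\<infinity>k\<in>K. (\<xi> k)\<^sup>2)"]
    by (metis infsum_nonneg real_sqrt_ge_zero zero_le_power2)
  have "(\<lambda>k. c k + C * (\<xi> k)\<^sup>2) summable_on K"
    using c(1) assms(1) by (intro summable_on_add summable_on_cmult_right)
  then show ?thesis
    using c(3) coordinate_bound[OF assms(1)] pos
    by (rule_tac summable_on_comparison_test) (auto simp: less_imp_le)
qed

lemma bdd_above_terms:
  assumes "(\<lambda>k. (\<xi> k)\<^sup>2) summable_on K" "p = \<infinity>"
  shows "bdd_above ((\<lambda>k. \<omega> k * \<bar>\<xi> k\<bar>) ` K)"
proof -
  obtain B where B: "\<And>k. k \<in> K \<Longrightarrow> \<omega> k \<le> B"
    using weights assms(2) by (auto simp: bdd_above_def)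
  show ?thesis
  proof (rule bdd_aboveI2)
    fix k assume k: "k \<in> K"
    show "\<omega> k * \<bar>\<xi> k\<bar> \<le> B * sqrt (\<Sum>\<^sub>\<infinity>k\<in>K. (\<xi> k)\<^sup>2)"
      using B[OF k] pos[OF k] coordinate_bound[OF assms(1) k] by (intro mult_mono) auto
  qed
qed

lemma weighted_lp_norm_mono:
  assumes \<xi>: "(\<lambda>k. (\<xi> k)\<^sup>2) summable_on K" and \<eta>: "(\<lambda>k. (\<eta> k)\<^sup>2) summable_on K"
    and le: "\<And>k. k \<in> K \<Longrightarrow> \<bar>\<xi> k\<bar> \<le> \<bar>\<eta> k\<bar>"
  shows "weighted_lp_norm K \<omega> p \<xi> \<le> weighted_lp_norm K \<omega> p \<eta>"
proof (cases "p < \<infinity>")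
  case True
  then have q: "1 \<le> real_of_ereal p" using p by (cases p) auto
  have "(\<Sum>\<^sub>\<infinity>k\<in>K. \<omega> k * \<bar>\<xi> k\<bar> powr real_of_ereal p) \<le> (\<Sum>\<^sub>\<infinity>k\<in>K. \<omega> k * \<bar>\<eta> k\<bar> powr real_of_ereal p)"
    using summable_terms[OF \<xi> True] summable_terms[OF \<eta> True] le pos q
    by (intro infsum_mono mult_left_mono powr_mono2) (auto simp: less_imp_le)
  then show ?thesis
    using True q pos by (auto simp: weighted_lp_norm_def less_imp_le intro!: powr_mono2 infsum_nonneg)
next
  case False
  then have "p = \<infinity>" by auto
  then show ?thesis
    using nonempty bdd_above_terms[OF \<eta>] le pos
    by (auto simp: weighted_lp_norm_def less_imp_le intro!: cSUP_subset_mono)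
qed

text \<open>
  Carries bounds on the unit ball over to arbitrary vectors.
\<close>

lemma weighted_lp_norm_scale_le:
  assumes \<xi>: "(\<lambda>k. (\<xi> k)\<^sup>2) summable_on K" and c: "0 \<le> c"
  shows "weighted_lp_norm K \<omega> p (\<lambda>k. c * \<xi> k) \<le> c * weighted_lp_norm K \<omega> p \<xi>"
proof (cases "p < \<infinity>")
  case True
  then have q: "1 \<le> real_of_ereal p" using p by (cases p) auto
  let ?S = "\<lambda>\<xi>. \<Sum>\<^sub>\<infinity>k\<in>K. \<omega> k * \<bar>\<xi> k\<bar> powr real_of_ereal p"
  have "?S (\<lambda>k. c * \<xi> k) = (\<Sum>\<^sub>\<infinity>k\<in>K. c powr real_of_ereal p * (\<omega> k * \<bar>\<xi> k\<bar> powr real_of_ereal p))"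
    using c by (intro infsum_cong) (simp add: abs_mult powr_mult)
  then have "?S (\<lambda>k. c * \<xi> k) = c powr real_of_ereal p * ?S \<xi>"
    by (simp add: infsum_cmult_right')
  moreover have "0 \<le> ?S \<xi>" using pos by (intro infsum_nonneg) (auto simp: less_imp_le)
  ultimately show ?thesis
    using True q c by (simp add: weighted_lp_norm_def powr_mult powr_powr)
next
  case False
  have "p = \<infinity>" using False by auto
  have "\<omega> k * \<bar>c * \<xi> k\<bar> \<le> c * (SUP k\<in>K. \<omega> k * \<bar>\<xi> k\<bar>)" if "k \<in> K" for k
    using mult_left_mono[OF cSUP_upper[OF that bdd_above_terms[OF \<xi> \<open>p = \<infinity>\<close>]] c] c
    by (simp add: abs_mult mult_ac)
  then show ?thesis
    using False nonempty by (auto simp: weighted_lp_norm_def intro!: cSUP_least)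
qed

text \<open>
  This makes the operator norm finite. For finite \<open>p\<close> it follows from the termwise bound by
  summation, for \<open>p = \<infinity>\<close> from the boundedness of the weights.
\<close>

lemma weighted_lp_norm_locally_bounded:
  assumes M: "0 \<le> M"
  obtains D where "\<And>\<xi>. (\<lambda>k. (\<xi> k)\<^sup>2) summable_on K \<Longrightarrow> (\<Sum>\<^sub>\<infinity>k\<in>K. (\<xi> k)\<^sup>2) \<le> M\<^sup>2 \<Longrightarrow>
    weighted_lp_norm K \<omega> p \<xi> \<le> D"
proof -
  have coord: "\<bar>\<xi> k\<bar> \<le> M"
    if "(\<lambda>k. (\<xi> k)\<^sup>2) summable_on K" "(\<Sum>\<^sub>\<infinity>k\<in>K. (\<xi> k)\<^sup>2) \<le> M\<^sup>2" "k \<in> K" for \<xi> k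
    using coordinate_bound[OF that(1,3)] real_sqrt_le_mono[OF that(2)] M by simp
  show thesis
  proof (cases "p < \<infinity>")
    case True
    then have q: "1 \<le> real_of_ereal p" using p by (cases p) auto
    obtain c C where c: "c summable_on K" "0 \<le> C"
      "\<And>k t. k \<in> K \<Longrightarrow> \<bar>t\<bar> \<le> M \<Longrightarrow> \<omega> k * \<bar>t\<bar> powr real_of_ereal p \<le> c k + C * t\<^sup>2"
      using term_bound[OF True M] by blast
    show thesis
    proof (rule that)
      fix \<xi> assume \<xi>: "(\<lambda>k. (\<xi> k)\<^sup>2) summable_on K" "(\<Sum>\<^sub>\<infinity>k\<in>K. (\<xi> k)\<^sup>2) \<le> M\<^sup>2"
      have "(\<Sum>\<^sub>\<infinity>k\<in>K. \<omega> k * \<bar>\<xi> k\<bar> powr real_of_ereal p) \<le> (\<Sum>\<^sub>\<infinity>k\<in>K. c k + C * (\<xi> k)\<^sup>2)"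
        using \<xi> c(1) True coord[OF \<xi>]
        by (intro infsum_mono summable_terms summable_on_add summable_on_cmult_right c(3))
      also have "\<dots> = infsum c K + C * (\<Sum>\<^sub>\<infinity>k\<in>K. (\<xi> k)\<^sup>2)"
        using \<xi> c(1) by (simp add: infsum_add summable_on_cmult_right infsum_cmult_right)
      also have "\<dots> \<le> infsum c K + C * M\<^sup>2"
        using \<xi>(2) c(2) by (intro add_left_mono mult_left_mono)
      finally show "weighted_lp_norm K \<omega> p \<xi> \<le> (infsum c K + C * M\<^sup>2) powr (1 / real_of_ereal p)"
        using True q pos by (auto simp: weighted_lp_norm_def less_imp_le intro!: powr_mono2 infsum_nonneg)
    qed
  next
    case False
    then obtain B where B: "\<And>k. k \<in> K \<Longrightarrow> \<omega> k \<le> B"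
      using weights by (auto simp: bdd_above_def)
    show thesis
    proof (rule that)
      fix \<xi> assume \<xi>: "(\<lambda>k. (\<xi> k)\<^sup>2) summable_on K" "(\<Sum>\<^sub>\<infinity>k\<in>K. (\<xi> k)\<^sup>2) \<le> M\<^sup>2"
      have "\<omega> k * \<bar>\<xi> k\<bar> \<le> B * M" if k: "k \<in> K" for k
        using B[OF k] pos[OF k] coord[OF \<xi> k] by (intro mult_mono) auto
      then show "weighted_lp_norm K \<omega> p \<xi> \<le> B * M"
        using False nonempty by (auto simp: weighted_lp_norm_def intro!: cSUP_least)
    qed
  qed
qed

end

section \<open>Continuous embeddings of norms\<close>

lemma Metric_space_norm_on:
  assumes V: "subspace V" and N: "is_norm_on V N"
  shows "Metric_space V (\<lambda>x y. if x \<in> V \<and> y \<in> V then N (x - y) else 0)"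
proof
  have diff: "x - y \<in> V" if "x \<in> V" "y \<in> V" for x y
    using V that by (rule subspace_diff)
  fix x y z :: 'a
  show "0 \<le> (if x \<in> V \<and> y \<in> V then N (x - y) else 0)"
    using N diff by (auto simp: is_norm_on_def)
  have "N (x - y) = N (y - x)" if "x \<in> V" "y \<in> V"
  proof -
    have "N ((-1) *\<^sub>R (y - x)) = \<bar>-1\<bar> * N (y - x)"
      using N diff[OF that(2,1)] unfolding is_norm_on_def by blast
    then show ?thesis by simp
  qed
  then show "(if x \<in> V \<and> y \<in> V then N (x - y) else 0) = (if y \<in> V \<and> x \<in> V then N (y - x) else 0)"
    by auto
  show "(if x \<in> V \<and> y \<in> V then N (x - y) else 0) = 0 \<longleftrightarrow> x = y" if "x \<in> V" "y \<in> V"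
    using N diff[OF that] that by (auto simp: is_norm_on_def)
  show "(if x \<in> V \<and> z \<in> V then N (x - z) else 0)
      \<le> (if x \<in> V \<and> y \<in> V then N (x - y) else 0) + (if y \<in> V \<and> z \<in> V then N (y - z) else 0)"
    if "x \<in> V" "y \<in> V" "z \<in> V"
  proof -
    have "N ((x - y) + (y - z)) \<le> N (x - y) + N (y - z)"
      using N diff[OF that(1,2)] diff[OF that(2,3)] unfolding is_norm_on_def by (simp only:)
    then show ?thesis using that by simp
  qed
qed

text \<open>
  Continuity at the origin gives a ball of radius \<open>\<delta>\<close> that the identity maps into the unit ball, and
  every vector is rescaled to half that radius.
\<close>

lemma continuously_embedded_bound:
  fixes N :: "'a::real_normed_vector \<Rightarrow> real"
  assumes V: "subspace V" and N: "is_norm_on V N" and emb: "continuously_embedded V N norm"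
  obtains C where "0 \<le> C" "\<And>x. x \<in> V \<Longrightarrow> norm x \<le> C * N x"
proof -
  have norm: "is_norm_on V norm" by (auto simp: is_norm_on_def norm_triangle_ineq)
  have "0 \<in> V" using V by (rule subspace_0)
  then have "\<exists>\<delta>>0. \<forall>x. x \<in> V \<and> (if 0 \<in> V \<and> x \<in> V then N (0 - x) else 0) < \<delta> \<longrightarrow>
               (if 0 \<in> V \<and> x \<in> V then norm (0 - x) else 0) < 1"
    using emb
    unfolding continuously_embedded_def norm_topology_def
      Metric_space.metric_continuous_map[OF Metric_space_norm_on[OF V N] Metric_space_norm_on[OF V norm]]
    by (metis (no_types, lifting) zero_less_one)
  then obtain \<delta> where \<delta>: "0 < \<delta>" "\<And>x. x \<in> V \<Longrightarrow> N (- x) < \<delta> \<Longrightarrow> norm x < 1"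
    using \<open>0 \<in> V\<close> by auto
  have "norm x \<le> (2 / \<delta>) * N x" if x: "x \<in> V" for x
  proof (cases "x = 0")
    case False
    have Nx: "0 < N x" using N x False by (force simp: is_norm_on_def less_le)
    let ?c = "\<delta> / (2 * N x)"
    have "N (- (?c *\<^sub>R x)) = \<bar>- ?c\<bar> * N x"
      using N x unfolding is_norm_on_def by (metis scaleR_minus_left)
    also have "\<dots> < \<delta>" using Nx \<delta>(1) by simp
    finally have "norm (?c *\<^sub>R x) < 1" using V x by (intro \<delta>) (simp_all add: subspace_scale)
    then show ?thesis using Nx \<delta>(1) by (simp add: field_simps)
  qed (use N x in \<open>auto simp: is_norm_on_def\<close>)
  then show thesis using \<delta>(1) by (intro that[of "2 / \<delta>"]) auto
qed

section \<open>Layered networks\<close>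

lemma averaged_real_contractive:
  fixes R :: "real \<Rightarrow> real"
  assumes "averaged \<alpha> R" "\<alpha> \<in> {0..1}"
  shows "\<bar>R s - R t\<bar> \<le> \<bar>s - t\<bar>"
proof -
  obtain Q where Q: "nonexpansive Q" "\<And>x. R x = (1 - \<alpha>) * x + \<alpha> * Q x"
    using assms(1) by (auto simp: averaged_def)
  have "\<bar>Q s - Q t\<bar> \<le> \<bar>s - t\<bar>"
    using Q(1) lipschitz_onD[of 1 UNIV Q s t] by (simp add: nonexpansive_def dist_real_def)
  moreover have "R s - R t = (1 - \<alpha>) * (s - t) + \<alpha> * (Q s - Q t)"
    by (simp add: Q(2) algebra_simps)
  then have "\<bar>R s - R t\<bar> \<le> (1 - \<alpha>) * \<bar>s - t\<bar> + \<alpha> * \<bar>Q s - Q t\<bar>"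
    using assms(2) abs_triangle_ineq[of "(1 - \<alpha>) * (s - t)" "\<alpha> * (Q s - Q t)"] by (simp add: abs_mult)
  ultimately have "\<bar>R s - R t\<bar> \<le> (1 - \<alpha>) * \<bar>s - t\<bar> + \<alpha> * \<bar>s - t\<bar>"
    using assms(2) mult_left_mono[of "\<bar>Q s - Q t\<bar>" "\<bar>s - t\<bar>" \<alpha>] by auto
  then show ?thesis by (simp add: algebra_simps)
qed

lemma path_weight_Suc:
  "path_weight (Suc j) W e (k(Suc j := x)) =
   path_weight j W e k * (W (Suc j) (e j (k j)) \<bullet> e (Suc j) x)"
proof -
  have "(\<Prod>i=1..j. W i (e (i - 1) ((k(Suc j := x)) (i - 1))) \<bullet> e i ((k(Suc j := x)) i)) =
        path_weight j W e k"
    unfolding path_weight_def by (rule prod.cong) auto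
  then show ?thesis by (simp add: path_weight_def)
qed

locale layered_network =
  fixes m :: nat and H :: "nat \<Rightarrow> 'a::real_inner set" and K :: "nat \<Rightarrow> 'k set"
    and e :: "nat \<Rightarrow> 'k \<Rightarrow> 'a" and W :: "nat \<Rightarrow> 'a \<Rightarrow> 'a"
  assumes hilbert: "\<And>i. i \<le> m \<Longrightarrow> hilbert_basis (H i) (K i) (e i)"
    and W: "\<And>i. i \<in> {1..m} \<Longrightarrow> bounded_linear_between (H (i - 1)) (H i) (W i)"
begin

definition layer :: "(nat \<Rightarrow> 'k \<Rightarrow> real) \<Rightarrow> nat \<Rightarrow> 'a \<Rightarrow> 'a" where
  "layer l i = hilbert_basis.diag (K i) (e i) (l i) \<circ> W i"

definition contractive :: "(nat \<Rightarrow> 'k \<Rightarrow> real) \<Rightarrow> bool" where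
  "contractive l \<longleftrightarrow> (\<forall>i\<in>{1..m}. \<forall>k\<in>K i. \<bar>l i k\<bar> \<le> 1)"

lemma contractiveD: "contractive l \<Longrightarrow> i \<in> {1..m} \<Longrightarrow> k \<in> K i \<Longrightarrow> \<bar>l i k\<bar> \<le> 1"
  by (simp add: contractive_def)

lemma layer_bounded_linear:
  assumes "contractive l" "i \<in> {1..m}"
  shows "bounded_linear_between (H (i - 1)) (H i) (layer l i)"
  unfolding layer_def
  using assms hilbert[of i] W
  by (intro bounded_linear_between_compose[of _ "H i"] hilbert_basis.diag_bounded_linear)
     (auto dest: contractiveD)

lemma fold_bounded_linear:
  assumes f: "\<And>i. i \<in> {1..m} \<Longrightarrow> bounded_linear_between (H (i - 1)) (H i) (f i)"
    and "j \<le> n" "n \<le> m"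
  shows "bounded_linear_between (H j) (H n) (fold f [Suc j..<Suc n])"
  using assms(2,3)
proof (induction n rule: dec_induct)
  case base
  show ?case by (auto simp: bounded_linear_between_def intro: exI[of _ 1])
next
  case (step n)
  then have "bounded_linear_between (H j) (H (Suc n)) (f (Suc n) \<circ> fold f [Suc j..<Suc n])"
    using f[of "Suc n"] by (intro bounded_linear_between_compose[of _ "H n"]) auto
  moreover have "[Suc j..<Suc (Suc n)] = [Suc j..<Suc n] @ [Suc n]"
    using step.hyps by simp
  ultimately show ?case by (simp add: o_def del: upt_Suc)
qed

lemma layers_bounded_linear:
  assumes "contractive l" "j \<le> n" "n \<le> m"
  shows "bounded_linear_between (H j) (H n) (fold (layer l) [Suc j..<Suc n])"
  using layer_bounded_linear[OF assms(1)] assms(2,3) by (rule fold_bounded_linear)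

lemma weights_bounded_linear:
  assumes "j \<le> n" "n \<le> m"
  shows "bounded_linear_between (H j) (H n) (fold W [Suc j..<Suc n])"
  using W assms by (rule fold_bounded_linear)

lemma coordinate_functional:
  assumes "bounded_linear_between U U' f"
  shows "bounded_linear_between U UNIV (\<lambda>y. f y \<bullet> v)"
proof -
  have "bounded_linear_between U' UNIV (\<lambda>y. y \<bullet> v)"
    using Cauchy_Schwarz_ineq2[of _ v]
    by (auto simp: bounded_linear_between_def inner_add_left mult.commute intro!: exI[of _ "norm v"])
  from bounded_linear_between_compose[OF assms this] show ?thesis by (simp add: o_def)
qed

text \<open>
  Agreement holds on the input space only: off the space \<^term>\<open>H i\<close>, the diagonal operator with unit
  entries is a projection rather than the identity.
\<close>

lemma fold_layers_one:
  assumes "\<And>i k. i \<in> {1..n} \<Longrightarrow> k \<in> K i \<Longrightarrow> l i k = 1" "n \<le> m" "x \<in> H 0"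
  shows "fold (layer l) [1..<Suc n] x = fold W [1..<Suc n] x"
  using assms
proof (induction n)
  case (Suc n)
  have "fold W [1..<Suc n] x \<in> H n"
    using weights_bounded_linear[of 0 n] Suc.prems by (auto dest: bounded_linear_betweenD(1))
  then have "W (Suc n) (fold W [1..<Suc n] x) \<in> H (Suc n)"
    using W[of "Suc n"] Suc.prems by (auto dest: bounded_linear_betweenD(1))
  then have "layer l (Suc n) (fold W [1..<Suc n] x) = W (Suc n) (fold W [1..<Suc n] x)"
    using Suc.prems hilbert[of "Suc n"] by (auto simp: layer_def intro!: hilbert_basis.diag_one)
  then show ?case using Suc by simp
qed simp

text \<open>
  The entries of the diagonal operators depend on the two inputs: those of layer \<open>i\<close> are the
  difference quotients of the activation functions at the two signals that reach this layer.
\<close>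

lemma network_difference:
  assumes \<rho>: "\<And>i k s t. i \<in> {1..m} \<Longrightarrow> k \<in> K i \<Longrightarrow> \<bar>\<rho> i k s - \<rho> i k t\<bar> \<le> \<bar>s - t\<bar>"
    and \<rho>0: "\<And>i k. i \<in> {1..m} \<Longrightarrow> k \<in> K i \<Longrightarrow> \<rho> i k 0 = 0"
    and R: "\<And>i x. i \<in> {1..m} \<Longrightarrow> x \<in> H i \<Longrightarrow> R i x = (\<Sum>\<^sub>\<infinity>k\<in>K i. \<rho> i k (x \<bullet> e i k) *\<^sub>R e i k)"
    and b: "\<And>i. i \<in> {1..m} \<Longrightarrow> b i \<in> H i"
    and x: "x \<in> H 0" and y: "y \<in> H 0"
  obtains l where "contractive l"
    "fold (\<lambda>i z. R i (W i z + b i)) [1..<Suc m] x - fold (\<lambda>i z. R i (W i z + b i)) [1..<Suc m] y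
     = fold (layer l) [1..<Suc m] (x - y)"
proof
  let ?f = "\<lambda>i z. R i (W i z + b i)"
  let ?T = "\<lambda>n. fold ?f [1..<Suc n]"
  let ?u = "\<lambda>i. W i (?T (i - 1) x) + b i" and ?v = "\<lambda>i. W i (?T (i - 1) y) + b i"
  let ?l = "\<lambda>i k. (\<rho> i k (?u i \<bullet> e i k) - \<rho> i k (?v i \<bullet> e i k)) / (?u i \<bullet> e i k - ?v i \<bullet> e i k)"
  show "contractive ?l"
    unfolding contractive_def
    using \<rho> by (auto simp: abs_divide divide_le_eq_1)
  have "?T n x \<in> H n \<and> ?T n y \<in> H n \<and> ?T n x - ?T n y = fold (layer ?l) [1..<Suc n] (x - y)"
    if "n \<le> m" for n
    using that
  proof (induction n)
    case 0
    then show ?case using x y by simp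
  next
    case (Suc n)
    then have i: "Suc n \<in> {1..m}" by auto
    interpret hb: hilbert_basis "H (Suc n)" "K (Suc n)" "e (Suc n)" using Suc.prems by (rule hilbert)
    interpret hb': hilbert_basis "H n" "K n" "e n" using Suc.prems by (intro hilbert) simp
    note Wn = W[OF i, simplified]
    have IH: "?T n x \<in> H n" "?T n y \<in> H n" "?T n x - ?T n y = fold (layer ?l) [1..<Suc n] (x - y)"
      using Suc by auto
    have step: "?T (Suc n) z = R (Suc n) (W (Suc n) (?T n z) + b (Suc n))" for z by simp
    have pre: "W (Suc n) (?T n z) + b (Suc n) \<in> H (Suc n)" if "?T n z \<in> H n" for z
      using that bounded_linear_betweenD(1)[OF Wn] b[OF i] by (intro subspace_add hb.subspace)
    have Rc: "R (Suc n) u = hb.combine (\<lambda>k. \<rho> (Suc n) k (u \<bullet> e (Suc n) k))" if "u \<in> H (Suc n)" for u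
      using R[OF i that] by (simp add: hb.combine_def)
    have le: "\<bar>\<rho> (Suc n) k t\<bar> \<le> \<bar>t\<bar>" if "k \<in> K (Suc n)" for k t
      using \<rho>[OF i that, of t 0] \<rho>0[OF i that] by simp
    have RH: "R (Suc n) u \<in> H (Suc n)" if "u \<in> H (Suc n)" for u
      using Rc[OF that] le by (simp add: hb.activation_in(1))
    have "?T (Suc n) x - ?T (Suc n) y = hb.diag (?l (Suc n)) (?u (Suc n) - ?v (Suc n))"
      using Rc[OF pre[OF IH(1)]] Rc[OF pre[OF IH(2)]]
        hb.activation_difference[of "\<rho> (Suc n)", OF \<rho>[OF i] \<rho>0[OF i]]
      by (simp only: step diff_Suc_1)
    also have "?u (Suc n) - ?v (Suc n) = W (Suc n) (?T n x - ?T n y)"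
      using bounded_linear_between_diff[OF Wn hb'.subspace IH(1,2)] by simp
    also have "hb.diag (?l (Suc n)) \<dots> = layer ?l (Suc n) (fold (layer ?l) [1..<Suc n] (x - y))"
      by (simp only: IH(3) layer_def o_def)
    also have "\<dots> = fold (layer ?l) [1..<Suc (Suc n)] (x - y)" by (simp only: fold_compose_Suc o_def)
    finally show ?case unfolding step using RH pre IH(1,2) by simp
  qed
  then show "?T m x - ?T m y = fold (layer ?l) [1..<Suc m] (x - y)" by blast
qed

end

locale sign_coherent_network = layered_network +
  assumes coherent: "\<And>k l. (\<forall>i\<le>m. k i \<in> K i) \<Longrightarrow> (\<forall>i<m. l i \<in> K i) \<Longrightarrow>
              path_weight m W e k * path_weight m W e (l(m := k m)) \<ge> 0"
begin

text \<open>
  A path of negative weight forces every path with the same end to have nonpositive weight.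
\<close>

lemma common_sign:
  assumes "\<kappa> \<in> K m"
  obtains s :: real where "\<bar>s\<bar> = 1"
    "\<And>k. (\<forall>i\<le>m. k i \<in> K i) \<Longrightarrow> k m = \<kappa> \<Longrightarrow> \<bar>path_weight m W e k\<bar> = s * path_weight m W e k"
proof (cases "\<exists>k. (\<forall>i\<le>m. k i \<in> K i) \<and> k m = \<kappa> \<and> path_weight m W e k < 0")
  case True
  then obtain k where k: "\<forall>i\<le>m. k i \<in> K i" "k m = \<kappa>" "path_weight m W e k < 0" by blast
  have "path_weight m W e l \<le> 0" if "\<forall>i\<le>m. l i \<in> K i" "l m = \<kappa>" for l
  proof -
    have "l(m := k m) = l" using that(2) k(2) by auto
    then have "0 \<le> path_weight m W e k * path_weight m W e l"
      using coherent[of k l] k(1) that(1) by simp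
    then show ?thesis using k(3) by (simp add: zero_le_mult_iff)
  qed
  then show thesis by (intro that[of "-1"]) auto
next
  case False
  then show thesis by (intro that[of 1]) (auto simp: not_less)
qed

text \<open>
  The signs of the entries of a single \<^term>\<open>W i\<close> are unconstrained, so domination fails for the
  coordinates at intermediate layers; only complete paths have a common sign. Therefore the
  weight of an initial segment \<open>(k\<^sub>0, \<dots>, k\<^sub>j)\<close> is carried along as a factor of the contribution of the
  remaining layers, and the induction runs backward from complete paths. In the step from \<open>j + 1\<close> to
  \<open>j\<close>, expanding the output of layer \<open>j + 1\<close> multiplies this factor by one more entry, which makes it
  the weight of a longer segment, and the comparison is term by term in a convergent series.
  Extending one index at a time avoids sums over sets of infinitely many paths, whose
  convergence would have to be justified separately.
\<close>

lemma tail_domination: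
  assumes l: "contractive l" and \<kappa>: "\<kappa> \<in> K m"
    and s: "\<And>k. (\<forall>i\<le>m. k i \<in> K i) \<Longrightarrow> k m = \<kappa> \<Longrightarrow> \<bar>path_weight m W e k\<bar> = s * path_weight m W e k"
    and "j \<le> m" "\<forall>i\<le>j. k i \<in> K i"
  shows "\<bar>path_weight j W e k * (fold (layer l) [Suc j..<Suc m] (e j (k j)) \<bullet> e m \<kappa>)\<bar>
         \<le> s * (path_weight j W e k * (fold W [Suc j..<Suc m] (e j (k j)) \<bullet> e m \<kappa>))"
  using assms(4,5)
proof (induction j arbitrary: k rule: inc_induct)
  case base
  \<comment> \<open>No layer remains: paths that end at \<open>\<kappa>\<close> are handled by the common sign, others contribute \<open>0\<close>.\<close>
  have "e m (k m) \<bullet> e m \<kappa> = (if k m = \<kappa> then 1 else 0)"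
    using hilbert_basis.orthonormal[OF hilbert[of m]] base \<kappa> by simp
  then show ?case using s[of k] base by simp
next
  case (step j)
  interpret dom: hilbert_basis "H j" "K j" "e j" using step.hyps by (intro hilbert) simp
  interpret cod: hilbert_basis "H (Suc j)" "K (Suc j)" "e (Suc j)" using step.hyps by (intro hilbert) simp
  let ?F = "\<lambda>y. fold (layer l) [Suc (Suc j)..<Suc m] y \<bullet> e m \<kappa>"
  let ?G = "\<lambda>y. fold W [Suc (Suc j)..<Suc m] y \<bullet> e m \<kappa>"
  let ?y = "e j (k j)" and ?w = "path_weight j W e k"
  have y: "?y \<in> H j" using step.prems by (intro dom.basis_in) simp
  have Wy: "W (Suc j) ?y \<in> H (Suc j)"
    using W[of "Suc j"] step.hyps y by (auto dest: bounded_linear_betweenD(1))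
  have lj: "\<bar>l (Suc j) x\<bar> \<le> 1" if "x \<in> K (Suc j)" for x
    using contractiveD[OF l _ that] step.hyps by simp
  have F: "bounded_linear_between (H (Suc j)) UNIV ?F"
    using step.hyps by (intro coordinate_functional[OF layers_bounded_linear[OF l]]) auto
  have G: "bounded_linear_between (H (Suc j)) UNIV ?G"
    using step.hyps by (intro coordinate_functional[OF weights_bounded_linear]) auto
  have "((\<lambda>x. (layer l (Suc j) ?y \<bullet> e (Suc j) x) * ?F (e (Suc j) x)) has_sum ?F (layer l (Suc j) ?y)) (K (Suc j))"
    using cod.diag_in[of "l (Suc j)", OF lj] by (intro cod.functional_expansion F) (simp add: layer_def)
  then have sumF: "((\<lambda>x. ?w * ((layer l (Suc j) ?y \<bullet> e (Suc j) x) * ?F (e (Suc j) x))) has_sum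
      ?w * ?F (layer l (Suc j) ?y)) (K (Suc j))"
    by (rule has_sum_cmult_right)
  have sumG: "((\<lambda>x. s * (?w * ((W (Suc j) ?y \<bullet> e (Suc j) x) * ?G (e (Suc j) x)))) has_sum
      s * (?w * ?G (W (Suc j) ?y))) (K (Suc j))"
    by (intro has_sum_cmult_right cod.functional_expansion G Wy)
  have "norm (?w * ?F (layer l (Suc j) ?y)) \<le> s * (?w * ?G (W (Suc j) ?y))"
  proof (rule norm_infsum_le[OF sumF sumG])
    fix x assume x: "x \<in> K (Suc j)"
    let ?k = "k(Suc j := x)" and ?c = "W (Suc j) ?y \<bullet> e (Suc j) x"
    have k: "\<forall>i\<le>Suc j. ?k i \<in> K i" using step.prems x by (auto simp: le_Suc_eq)
    have "layer l (Suc j) ?y \<bullet> e (Suc j) x = l (Suc j) x * ?c"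
      using cod.inner_diag[of "l (Suc j)", OF lj x] by (simp add: layer_def)
    then have "norm (?w * ((layer l (Suc j) ?y \<bullet> e (Suc j) x) * ?F (e (Suc j) x)))
        = \<bar>l (Suc j) x\<bar> * \<bar>path_weight (Suc j) W e ?k * ?F (e (Suc j) x)\<bar>"
      by (simp add: path_weight_Suc abs_mult)
    also have "\<dots> \<le> 1 * \<bar>path_weight (Suc j) W e ?k * ?F (e (Suc j) x)\<bar>"
      using lj[OF x] by (intro mult_right_mono) auto
    also have "\<dots> \<le> s * (path_weight (Suc j) W e ?k * ?G (e (Suc j) x))"
      using step.IH[OF k] by (simp only: mult_1 fun_upd_same)
    finally show "norm (?w * ((layer l (Suc j) ?y \<bullet> e (Suc j) x) * ?F (e (Suc j) x)))
        \<le> s * (?w * (?c * ?G (e (Suc j) x)))"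
      by (simp add: path_weight_Suc mult.assoc)
  qed
  moreover have "[Suc j..<Suc m] = Suc j # [Suc (Suc j)..<Suc m]"
    using step.hyps by (simp add: upt_conv_Cons)
  ultimately show ?case by simp
qed

lemma domination:
  assumes l: "contractive l" and z: "z \<in> H 0" and \<kappa>: "\<kappa> \<in> K m"
  shows "\<bar>fold (layer l) [1..<Suc m] z \<bullet> e m \<kappa>\<bar>
     \<le> \<bar>fold W [1..<Suc m] (hilbert_basis.modulus (K 0) (e 0) z) \<bullet> e m \<kappa>\<bar>"
proof -
  interpret inp: hilbert_basis "H 0" "K 0" "e 0" by (rule hilbert) simp
  let ?F = "\<lambda>y. fold (layer l) [1..<Suc m] y \<bullet> e m \<kappa>"
  let ?G = "\<lambda>y. fold W [1..<Suc m] y \<bullet> e m \<kappa>"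
  obtain s :: real where s: "\<bar>s\<bar> = 1"
    "\<And>k. (\<forall>i\<le>m. k i \<in> K i) \<Longrightarrow> k m = \<kappa> \<Longrightarrow> \<bar>path_weight m W e k\<bar> = s * path_weight m W e k"
    using common_sign[OF \<kappa>] by blast
  have entry: "\<bar>?F (e 0 x)\<bar> \<le> s * ?G (e 0 x)" if "x \<in> K 0" for x
    using tail_domination[OF l \<kappa> s(2), of 0 "\<lambda>_. x"] that by (simp add: path_weight_def)
  have F: "bounded_linear_between (H 0) UNIV ?F"
    using layers_bounded_linear[OF l, of 0 m] by (intro coordinate_functional) simp_all
  have G: "bounded_linear_between (H 0) UNIV ?G"
    using weights_bounded_linear[of 0 m] by (intro coordinate_functional) simp_all
  have sumF: "((\<lambda>x. (z \<bullet> e 0 x) * ?F (e 0 x)) has_sum ?F z) (K 0)"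
    by (rule inp.functional_expansion[OF F z])
  have sumG: "((\<lambda>x. s * ((inp.modulus z \<bullet> e 0 x) * ?G (e 0 x))) has_sum s * ?G (inp.modulus z)) (K 0)"
    by (intro has_sum_cmult_right inp.functional_expansion[OF G] inp.modulus_in)
  have "norm (?F z) \<le> s * ?G (inp.modulus z)"
  proof (rule norm_infsum_le[OF sumF sumG])
    fix x assume x: "x \<in> K 0"
    show "norm ((z \<bullet> e 0 x) * ?F (e 0 x)) \<le> s * ((inp.modulus z \<bullet> e 0 x) * ?G (e 0 x))"
      using mult_left_mono[OF entry[OF x], of "\<bar>z \<bullet> e 0 x\<bar>"] x
      by (simp only: inp.inner_modulus real_norm_def abs_mult abs_ge_zero mult.left_commute)
  qed
  also have "\<dots> \<le> \<bar>s * ?G (inp.modulus z)\<bar>" by simp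
  also have "\<dots> = \<bar>?G (inp.modulus z)\<bar>" using s(1) by (simp add: abs_mult)
  finally show ?thesis by simp
qed

end

section \<open>The Lipschitz constant\<close>

theorem proposition5p10:
  fixes m :: nat
    and H :: "nat \<Rightarrow> 'a::real_inner set"
    and K :: "nat \<Rightarrow> nat set"
    and e :: "nat \<Rightarrow> nat \<Rightarrow> 'a"
    and W :: "nat \<Rightarrow> 'a \<Rightarrow> 'a"
    and b :: "nat \<Rightarrow> 'a"
    and \<alpha> :: "nat \<Rightarrow> real"
    and \<rho> :: "nat \<Rightarrow> nat \<Rightarrow> real \<Rightarrow> real"
    and R :: "nat \<Rightarrow> 'a \<Rightarrow> 'a"
    and T :: "'a \<Rightarrow> 'a"
    and N0 Nm :: "'a \<Rightarrow> real"
    and p :: ereal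
    and \<omega> :: "nat \<Rightarrow> real"
    and \<theta> :: ennreal
  assumes m: "2 \<le> m"
    and H: "\<And>i. i \<le> m \<Longrightarrow> hilbert_space_on (H i) \<and> separable_on (H i) \<and> H i \<noteq> {0}"
    and K: "\<And>i. i \<le> m \<Longrightarrow> K i \<noteq> {}"
    and e: "\<And>i. i \<le> m \<Longrightarrow> orthonormal_basis_on (H i) (K i) (e i)"
    and W: "\<And>i. i \<in> {1..m} \<Longrightarrow> bounded_linear_between (H (i - 1)) (H i) (W i)"
    and b: "\<And>i. i \<in> {1..m} \<Longrightarrow> b i \<in> H i"
    and \<alpha>: "\<And>i. i \<in> {1..m} \<Longrightarrow> \<alpha> i \<in> {0..1}"
    and \<rho>: "\<And>i k. i \<in> {1..m} \<Longrightarrow> k \<in> K i \<Longrightarrow> averaged (\<alpha> i) (\<rho> i k) \<and> \<rho> i k 0 = 0"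
    and R: "\<And>i x. i \<in> {1..m} \<Longrightarrow> x \<in> H i \<Longrightarrow>
              R i x = (\<Sum>\<^sub>\<infinity>k\<in>K i. \<rho> i k (x \<bullet> e i k) *\<^sub>R e i k)"
    and T: "\<And>x. x \<in> H 0 \<Longrightarrow> T x = fold (\<lambda>i y. R i (W i y + b i)) [1..<m+1] x"
    and N0_norm: "is_norm_on (H 0) N0"
    and N0_embedded: "continuously_embedded (H 0) N0 norm"
    and N0_abs: "\<And>\<xi>. (\<lambda>k. (\<xi> k)\<^sup>2) summable_on K 0 \<Longrightarrow>
              N0 (\<Sum>\<^sub>\<infinity>k\<in>K 0. \<xi> k *\<^sub>R e 0 k) = N0 (\<Sum>\<^sub>\<infinity>k\<in>K 0. \<bar>\<xi> k\<bar> *\<^sub>R e 0 k)"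
    and p: "1 \<le> p"
    and \<omega>_pos: "\<And>k. k \<in> K m \<Longrightarrow> 0 < \<omega> k"
    and \<omega>: "(p < 2 \<and> (\<lambda>k. \<omega> k powr (2 / (2 - real_of_ereal p))) summable_on K m) \<or>
            (2 \<le> p \<and> bdd_above (\<omega> ` K m))"
    and Nm: "\<And>x. x \<in> H m \<Longrightarrow>
              Nm x = (if p < \<infinity>
                then (\<Sum>\<^sub>\<infinity>k\<in>K m. \<omega> k * \<bar>x \<bullet> e m k\<bar> powr real_of_ereal p) powr (1 / real_of_ereal p)
                else (SUP k\<in>K m. \<omega> k * \<bar>x \<bullet> e m k\<bar>))"
    and \<mu>: "\<And>k l. (\<forall>i\<le>m. k i \<in> K i) \<Longrightarrow> (\<forall>i<m. l i \<in> K i) \<Longrightarrow>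
              path_weight m W e k * path_weight m W e (l(m := k m)) \<ge> 0"
    and \<theta>: "\<theta> = (SUP \<Lambda>\<in>{\<Lambda>. \<forall>i\<in>{1..m-1}. \<Lambda> i \<in> diagonal_operators {1 - 2 * \<alpha> i, 1} (K i) (e i)}.
              operator_norm (H 0) N0 Nm (W m \<circ> fold (\<lambda>i. \<Lambda> i \<circ> W i) [1..<m]))"
  shows "\<theta> < \<infinity> \<and> is_lipschitz_constant (H 0) N0 Nm T (enn2real \<theta>) \<and>
         \<theta> = operator_norm (H 0) N0 Nm (fold W [1..<m+1])"
proof -
  interpret net: sign_coherent_network m H K e W
    using H e W \<mu> by unfold_locales auto
  interpret inp: hilbert_basis "H 0" "K 0" "e 0" by (rule net.hilbert) simp
  interpret out: hilbert_basis "H m" "K m" "e m" by (rule net.hilbert) simp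
  interpret lp: lp_weights "K m" \<omega> p
    using K[of m] p \<omega>_pos \<omega> by unfold_locales auto
  let ?W = "fold W [1..<Suc m]"
  let ?coord = "\<lambda>x k. x \<bullet> e m k"
  have Nm': "Nm x = weighted_lp_norm (K m) \<omega> p (?coord x)" if "x \<in> H m" for x
    using Nm[OF that] by (simp add: weighted_lp_norm_def)
  have W_bl: "bounded_linear_between (H 0) (H m) ?W"
    using net.weights_bounded_linear[of 0 m] by simp

  have N0_modulus: "N0 (inp.modulus z) = N0 z" if "z \<in> H 0" for z
    using N0_abs[OF inp.square_summable_coordinates[of z]] inp.combine_coordinates[OF that]
    by (simp add: inp.modulus_def inp.combine_def)
  have dominated: "Nm (fold (net.layer l) [1..<Suc m] z) \<le> Nm (?W (inp.modulus z))"
    if l: "net.contractive l" and z: "z \<in> H 0" for l z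
  proof -
    have "fold (net.layer l) [1..<Suc m] z \<in> H m"
      using bounded_linear_betweenD(1)[OF net.layers_bounded_linear[OF l, of 0 m]] z by simp
    moreover have "?W (inp.modulus z) \<in> H m"
      using bounded_linear_betweenD(1)[OF W_bl] inp.modulus_in by blast
    ultimately show ?thesis
      using lp.weighted_lp_norm_mono[OF out.square_summable_coordinates out.square_summable_coordinates]
        net.domination[OF l z] by (simp only: Nm')
  qed

  let ?\<theta> = "operator_norm (H 0) N0 Nm ?W"
  have finite: "?\<theta> < \<infinity>"
  proof -
    obtain C where C: "0 \<le> C" "\<And>x. x \<in> H 0 \<Longrightarrow> norm x \<le> C * N0 x"
      using continuously_embedded_bound[OF inp.subspace N0_norm N0_embedded] by blast
    obtain B where B: "0 \<le> B" "\<And>x. x \<in> H 0 \<Longrightarrow> norm (?W x) \<le> B * norm x"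
      using bounded_linear_between_bound[OF W_bl] by blast
    obtain D where D: "\<And>\<xi>. (\<lambda>k. (\<xi> k)\<^sup>2) summable_on K m \<Longrightarrow>
        (\<Sum>\<^sub>\<infinity>k\<in>K m. (\<xi> k)\<^sup>2) \<le> (B * C)\<^sup>2 \<Longrightarrow> weighted_lp_norm (K m) \<omega> p \<xi> \<le> D"
      using lp.weighted_lp_norm_locally_bounded[of "B * C"] B(1) C(1) by (metis mult_nonneg_nonneg)
    have "Nm (?W x) \<le> D" if x: "x \<in> H 0" "N0 x \<le> 1" for x
    proof -
      have "norm (?W x) \<le> B * norm x" using x(1) by (rule B(2))
      also have "\<dots> \<le> B * (C * N0 x)" using B(1) C(2)[OF x(1)] by (intro mult_left_mono)
      also have "\<dots> \<le> B * (C * 1)" using B(1) C(1) x(2) by (intro mult_left_mono)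
      finally have "(norm (?W x))\<^sup>2 \<le> (B * C)\<^sup>2" by (intro power_mono) simp_all
      with out.bessel have "(\<Sum>\<^sub>\<infinity>k\<in>K m. (?coord (?W x) k)\<^sup>2) \<le> (B * C)\<^sup>2" by (rule order_trans)
      then show ?thesis
        using D[OF out.square_summable_coordinates] Nm'[OF bounded_linear_betweenD(1)[OF W_bl x(1)]]
        by (simp only:)
    qed
    then have "?\<theta> \<le> ennreal D"
      unfolding operator_norm_def by (intro SUP_least ennreal_leI) auto
    then show ?thesis by (auto simp: le_less_trans)
  qed
  have unit_ball: "ennreal (Nm (?W x)) \<le> ?\<theta>" if "x \<in> H 0" "N0 x \<le> 1" for x
    unfolding operator_norm_def using that by (intro SUP_upper) auto
  \<comment> \<open>The operator norm is a supremum over the unit ball, so vectors are rescaled by their norm.\<close>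
  have bound: "Nm (?W z) \<le> enn2real ?\<theta> * N0 z" if z: "z \<in> H 0" for z
  proof (cases "z = 0")
    case True
    have "?W 0 = 0"
      using bounded_linear_betweenD(3)[OF W_bl z, of 0] True by simp
    moreover have "Nm 0 \<le> 0 * Nm 0"
      using lp.weighted_lp_norm_scale_le[OF out.square_summable_coordinates[of 0], of 0] out.subspace
      by (simp add: Nm' subspace_0)
    moreover have "N0 0 = 0" using N0_norm z True by (auto simp: is_norm_on_def)
    ultimately show ?thesis using True by simp
  next
    case False
    then have N0z: "0 < N0 z" using N0_norm z by (force simp: is_norm_on_def less_le)
    let ?z = "(1 / N0 z) *\<^sub>R z"
    have z': "?z \<in> H 0" using inp.subspace z by (rule subspace_scale)
    have "N0 ?z = \<bar>1 / N0 z\<bar> * N0 z" using N0_norm z unfolding is_norm_on_def by blast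
    then have "N0 ?z \<le> 1" using N0z by simp
    then have le: "Nm (?W ?z) \<le> enn2real ?\<theta>"
      using unit_ball[OF z'] finite enn2real_mono[of "ennreal (Nm (?W ?z))" ?\<theta>]
      by (cases "0 \<le> Nm (?W ?z)") (auto simp: order_trans[OF _ enn2real_nonneg])
    have "?W z = N0 z *\<^sub>R ?W ?z"
      using bounded_linear_betweenD(3)[OF W_bl z', of "N0 z"] N0z by simp
    then have "?coord (?W z) = (\<lambda>k. N0 z * ?coord (?W ?z) k)" by (auto simp only: inner_scaleR_left)
    then have "Nm (?W z) \<le> N0 z * Nm (?W ?z)"
      using lp.weighted_lp_norm_scale_le[OF out.square_summable_coordinates[of "?W ?z"] less_imp_le[OF N0z]]
        Nm'[OF bounded_linear_betweenD(1)[OF W_bl z]] Nm'[OF bounded_linear_betweenD(1)[OF W_bl z']]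
      by (simp only:)
    also have "\<dots> \<le> N0 z * enn2real ?\<theta>" using le N0z by (intro mult_left_mono) auto
    finally show ?thesis by (simp only: mult.commute)
  qed

  have \<theta>_eq: "\<theta> = ?\<theta>"
  proof (rule antisym)
    show "\<theta> \<le> ?\<theta>"
      unfolding \<theta>
    proof (rule SUP_least)
      fix \<Lambda> assume \<Lambda>: "\<Lambda> \<in> {\<Lambda>. \<forall>i\<in>{1..m-1}. \<Lambda> i \<in> diagonal_operators {1 - 2 * \<alpha> i, 1} (K i) (e i)}"
      have "\<exists>l. l ` K i \<subseteq> {1 - 2 * \<alpha> i, 1} \<and> \<Lambda> i = hilbert_basis.diag (K i) (e i) l"
        if i: "i \<in> {1..m-1}" for i
      proof -
        have "\<Lambda> i \<in> diagonal_operators {1 - 2 * \<alpha> i, 1} (K i) (e i)" using \<Lambda> i by blast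
        moreover have "i \<le> m" using i by auto
        ultimately show ?thesis
          unfolding hilbert_basis.diagonal_operators_eq[OF net.hilbert[OF \<open>i \<le> m\<close>]] by blast
      qed
      then obtain l where l: "\<And>i. i \<in> {1..m-1} \<Longrightarrow> l i ` K i \<subseteq> {1 - 2 * \<alpha> i, 1}"
        "\<And>i. i \<in> {1..m-1} \<Longrightarrow> \<Lambda> i = hilbert_basis.diag (K i) (e i) (l i)"
        by metis
      \<comment> \<open>The supremum has no diagonal operator after the last layer; the entries \<open>1\<close> supply one.\<close>
      define l' where "l' = l(m := (\<lambda>_. 1))"
      have contr: "net.contractive l'"
        unfolding net.contractive_def
      proof (intro ballI)
        fix i k assume i: "i \<in> {1..m}" and k: "k \<in> K i"
        show "\<bar>l' i k\<bar> \<le> 1"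
        proof (cases "i = m")
          case False
          then have "i \<in> {1..m-1}" using i by auto
          then have "l i k \<in> {1 - 2 * \<alpha> i, 1}" using l(1) k by blast
          then show ?thesis using \<alpha>[OF i] False by (auto simp: l'_def)
        qed (simp add: l'_def)
      qed
      have factor: "(W m \<circ> fold (\<lambda>i. \<Lambda> i \<circ> W i) [1..<m]) z = fold (net.layer l') [1..<Suc m] z"
        if z: "z \<in> H 0" for z
      proof -
        have inner: "fold (\<lambda>i. \<Lambda> i \<circ> W i) [1..<m] = fold (net.layer l') [1..<m]"
          by (rule ext, rule fold_cong) (auto simp: net.layer_def l'_def l(2))
        have "fold (net.layer l') [1..<m] z \<in> H (m - 1)"
          using bounded_linear_betweenD(1)[OF net.layers_bounded_linear[OF contr, of 0 "m - 1"]] z m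
          by simp
        then have "W m (fold (net.layer l') [1..<m] z) \<in> H m"
          using bounded_linear_betweenD(1)[OF W[of m]] m by simp
        then show ?thesis
          using m out.diag_one[of "W m (fold (net.layer l') [1..<m] z)" "l' m"]
          by (simp add: inner[unfolded One_nat_def] net.layer_def l'_def)
      qed
      show "operator_norm (H 0) N0 Nm (W m \<circ> fold (\<lambda>i. \<Lambda> i \<circ> W i) [1..<m]) \<le> ?\<theta>"
        unfolding operator_norm_def[of _ _ _ "W m \<circ> fold (\<lambda>i. \<Lambda> i \<circ> W i) [1..<m]"]
      proof (rule SUP_least)
        fix x assume "x \<in> {x \<in> H 0. N0 x \<le> 1}"
        then have x: "x \<in> H 0" "N0 x \<le> 1" by simp_all
        have "ennreal (Nm (fold (net.layer l') [1..<Suc m] x)) \<le> ennreal (Nm (?W (inp.modulus x)))"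
          by (intro ennreal_leI dominated contr x)
        also have "\<dots> \<le> ?\<theta>"
          using x N0_modulus[OF x(1)] by (intro unit_ball inp.modulus_in) simp
        finally show "ennreal (Nm ((W m \<circ> fold (\<lambda>i. \<Lambda> i \<circ> W i) [1..<m]) x)) \<le> ?\<theta>"
          by (simp only: factor[OF x(1)])
      qed
    qed
  next
    \<comment> \<open>The identity is an admissible choice in every layer.\<close>
    let ?I = "\<lambda>i. hilbert_basis.diag (K i) (e i) (\<lambda>_. 1)"
    have "?I i \<in> diagonal_operators {1 - 2 * \<alpha> i, 1} (K i) (e i)" if i: "i \<in> {1..m-1}" for i
    proof -
      have "i \<le> m" using i by auto
      show ?thesis
        unfolding hilbert_basis.diagonal_operators_eq[OF net.hilbert[OF \<open>i \<le> m\<close>]] by blast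
    qed
    then have "operator_norm (H 0) N0 Nm (W m \<circ> fold (\<lambda>i. ?I i \<circ> W i) [1..<m]) \<le> \<theta>"
      unfolding \<theta> by (intro SUP_upper) simp
    moreover have "(W m \<circ> fold (\<lambda>i. ?I i \<circ> W i) [1..<m]) x = ?W x" if x: "x \<in> H 0" for x
    proof -
      have "fold (net.layer (\<lambda>_ _. 1)) [1..<Suc (m - 1)] x = fold W [1..<Suc (m - 1)] x"
        using x by (intro net.fold_layers_one) auto
      moreover have "(\<lambda>i. ?I i \<circ> W i) = net.layer (\<lambda>_ _. 1)"
        by (auto simp: net.layer_def)
      ultimately show ?thesis using m by simp
    qed
    then have "operator_norm (H 0) N0 Nm (W m \<circ> fold (\<lambda>i. ?I i \<circ> W i) [1..<m]) = ?\<theta>"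
      unfolding operator_norm_def by (intro SUP_cong) auto
    ultimately show "?\<theta> \<le> \<theta>" by simp
  qed

  have lipschitz: "is_lipschitz_constant (H 0) N0 Nm T (enn2real ?\<theta>)"
    unfolding is_lipschitz_constant_def
  proof (intro conjI ballI)
    fix x y assume x: "x \<in> H 0" and y: "y \<in> H 0"
    have xy: "x - y \<in> H 0" using inp.subspace x y by (rule subspace_diff)
    have \<rho>1: "\<bar>\<rho> i k s - \<rho> i k t\<bar> \<le> \<bar>s - t\<bar>" if "i \<in> {1..m}" "k \<in> K i" for i k s t
      using averaged_real_contractive \<rho>[OF that] \<alpha>[OF that(1)] by blast
    have \<rho>0: "\<rho> i k 0 = 0" if "i \<in> {1..m}" "k \<in> K i" for i k
      using \<rho>[OF that] by blast
    obtain l where l: "net.contractive l"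
      "fold (\<lambda>i z. R i (W i z + b i)) [1..<Suc m] x - fold (\<lambda>i z. R i (W i z + b i)) [1..<Suc m] y
       = fold (net.layer l) [1..<Suc m] (x - y)"
      by (rule net.network_difference[OF \<rho>1 \<rho>0 R b x y])
    have "T x - T y = fold (net.layer l) [1..<Suc m] (x - y)"
      using l(2) T[OF x] T[OF y] by (simp only: Suc_eq_plus1)
    then have "Nm (T x - T y) \<le> Nm (?W (inp.modulus (x - y)))"
      using dominated[OF l(1) xy] by (simp only:)
    also have "\<dots> \<le> enn2real ?\<theta> * N0 (inp.modulus (x - y))"
      by (intro bound inp.modulus_in)
    also have "\<dots> = enn2real ?\<theta> * N0 (x - y)" by (simp only: N0_modulus[OF xy])
    finally show "Nm (T x - T y) \<le> enn2real ?\<theta> * N0 (x - y)" .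
  qed simp

  show ?thesis
    using finite lipschitz by (simp only: \<theta>_eq Suc_eq_plus1 simp_thms)
qed

end
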